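(* The graph $G_3$ defined as follows is a subcubic outerplanar graph with no $(1^2,2^2,5)$-packing edge-coloring. Let $G_1$ be the graph on vertices $u_1,\dots,u_{11}$ consisting of the $5$-cycle $u_1u_2u_3u_4u_5u_1$ together with the edges $u_2u_6, u_3u_7, u_6u_7, u_6u_8, u_7u_8$ and $u_5u_9, u_4u_{10}, u_9u_{10}, u_9u_{11}, u_{10}u_{11}$. Let $G_2$ be the graph formed from seven disjoint copies of $G_1$, arranged as a central copy (with vertices $u_1,\dots,u_{11}$), two second-level copies and four third-level copies, by adding edges as follows: the vertices $u_8$ and $u_{11}$ of the central copy are each joined by an edge to the vertex corresponding to $u_1$ of a different second-level copy; and in each second-level copy, the vertices corresponding to $u_8$ and $u_{11}$ are each joined by an edge to the vertex corresponding to $u_1$ of a different third-level copy (each third-level copy being used once). Let $G_{2a},\dots,G_{2e}$ be five disjoint copies of $G_2$, and let $u_{1a},\dots,u_{1e}$ be their vertices corresponding to the vertex $u_1$ of the central copy in $G_2$. Then $G_3$ consists of $G_{2a},\dots,G_{2e}$ and new vertices $v_1,\dots,v_{13}$ with the edges $v_1v_2, v_1v_4, v_1v_5, v_2v_3, v_2u_{1a}$; the edges $v_4v_6, v_4v_7, v_6v_7, v_6v_8, v_7v_9, v_8v_9, v_8u_{1b}, v_9u_{1c}$; and the edges $v_5v_{10}, v_5v_{11}, v_{10}v_{11}, v_{10}v_{12}, v_{11}v_{13}, v_{12}v_{13}, v_{12}u_{1d}, v_{13}u_{1e}$.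
   Context: A graph is subcubic if its maximum degree is at most $3$. The distance between two distinct edges of a graph is their distance in its line graph, so edges sharing an endpoint are at distance $1$. For a non-decreasing sequence $S=(s_1,\dots,s_k)$ of positive integers, an $S$-packing edge-coloring of a graph $H$ is a partition of $E(H)$ into (possibly empty) classes $E_1,\dots,E_k$ such that, for each $i$, any two distinct edges in $E_i$ are at distance at least $s_i+1$. Exponents denote repetition: $(1^2,2^2,5)=(1,1,2,2,5)$. *)

theory Defs
  imports "HOL-Analysis.Analysis" "HOL-Library.Extended_Nat"
begin

datatype 'a graph = Graph (verts: "'a set") (edges: "'a set set")

definition simple_graph :: "'a graph \<Rightarrow> bool" where
  "simple_graph G \<longleftrightarrow> finite (verts G) \<and> (\<forall>e\<in>edges G. e \<subseteq> verts G \<and> card e = 2)"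

definition degree :: "'a graph \<Rightarrow> 'a \<Rightarrow> nat" where
  "degree G v = card {e \<in> edges G. v \<in> e}"

definition subcubic :: "'a graph \<Rightarrow> bool" where
  "subcubic G \<longleftrightarrow> (\<forall>v\<in>verts G. degree G v \<le> 3)"

definition walk :: "'a graph \<Rightarrow> 'a list \<Rightarrow> bool" where
  "walk G xs \<longleftrightarrow>
     xs \<noteq> [] \<and> set xs \<subseteq> verts G \<and> successively (\<lambda>x y. {x, y} \<in> edges G) xs"

text \<open>The infimum of the empty set is \<open>\<infinity>\<close>, so vertices in different components are
  infinitely far apart.\<close>

definition graph_dist :: "'a graph \<Rightarrow> 'a \<Rightarrow> 'a \<Rightarrow> enat" where
  "graph_dist G x y = Inf {enat (length xs - 1) | xs. walk G xs \<and> hd xs = x \<and> last xs = y}"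

definition line_graph :: "'a graph \<Rightarrow> 'a set graph" where
  "line_graph G = Graph (edges G)
     {{e, f} | e f. e \<in> edges G \<and> f \<in> edges G \<and> e \<noteq> f \<and> e \<inter> f \<noteq> {}}"

text \<open>The class \<open>C i\<close> belongs to the entry \<open>S ! i\<close> (indices start at 0); classes may be empty.\<close>

definition packing_edge_coloring :: "nat list \<Rightarrow> 'a graph \<Rightarrow> (nat \<Rightarrow> 'a set set) \<Rightarrow> bool" where
  "packing_edge_coloring S G C \<longleftrightarrow>
     (\<Union>i<length S. C i) = edges G \<and>
     disjoint_family_on C {..<length S} \<and>
     (\<forall>i<length S. \<forall>e\<in>C i. \<forall>f\<in>C i. e \<noteq> f \<longrightarrow>
        graph_dist (line_graph G) e f \<ge> enat (S ! i + 1))"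

text \<open>A drawing without crossings: \<open>p\<close> places the vertices and \<open>\<gamma> e\<close> is a simple arc joining
  the two ends of \<open>e\<close>.\<close>

definition plane_drawing ::
    "'a graph \<Rightarrow> ('a \<Rightarrow> complex) \<Rightarrow> ('a set \<Rightarrow> real \<Rightarrow> complex) \<Rightarrow> bool" where
  "plane_drawing G p \<gamma> \<longleftrightarrow>
     inj_on p (verts G) \<and>
     (\<forall>e\<in>edges G. arc (\<gamma> e) \<and> {pathstart (\<gamma> e), pathfinish (\<gamma> e)} = p ` e) \<and>
     (\<forall>e\<in>edges G. \<forall>v\<in>verts G. p v \<in> path_image (\<gamma> e) \<longrightarrow> v \<in> e) \<and>
     (\<forall>e\<in>edges G. \<forall>f\<in>edges G. e \<noteq> f \<longrightarrow>
        path_image (\<gamma> e) \<inter> path_image (\<gamma> f) \<subseteq> p ` (e \<inter> f))"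

definition drawn_set ::
    "'a graph \<Rightarrow> ('a \<Rightarrow> complex) \<Rightarrow> ('a set \<Rightarrow> real \<Rightarrow> complex) \<Rightarrow> complex set" where
  "drawn_set G p \<gamma> = p ` verts G \<union> (\<Union>e\<in>edges G. path_image (\<gamma> e))"

text \<open>For a finite graph the drawn set is compact, so its \<^const>\<open>outside\<close> is the outer
  (unbounded) face.\<close>

definition outerplanar :: "'a graph \<Rightarrow> bool" where
  "outerplanar G \<longleftrightarrow>
     (\<exists>p \<gamma>. plane_drawing G p \<gamma> \<and> p ` verts G \<subseteq> frontier (outside (drawn_set G p \<gamma>)))"

text \<open>In \<open>G1\<close> the vertex \<open>i\<close> stands for $u_i$.\<close>

definition G1 :: "nat graph" where
  "G1 = Graph {1..11}
     {{1, 2}, {2, 3}, {3, 4}, {4, 5}, {5, 1},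
      {2, 6}, {3, 7}, {6, 7}, {6, 8}, {7, 8},
      {5, 9}, {4, 10}, {9, 10}, {9, 11}, {10, 11}}"

text \<open>In \<open>G2\<close> the vertex \<open>(c, i)\<close> is the vertex $u_i$ of copy \<open>c\<close> of \<open>G1\<close>. Copy 1 is the
  central one, copies 2 and 3 are second-level, copies 4 to 7 third-level.\<close>

definition G2 :: "(nat \<times> nat) graph" where
  "G2 = Graph ({1..7} \<times> verts G1)
     ((\<Union>c\<in>{1..7}. (\<lambda>e. Pair c ` e) ` edges G1) \<union>
      {{(1, 8), (2, 1)}, {(1, 11), (3, 1)},
       {(2, 8), (4, 1)}, {(2, 11), (5, 1)},
       {(3, 8), (6, 1)}, {(3, 11), (7, 1)}})"

datatype label = La | Lb | Lc | Ld | Le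

text \<open>\<open>V j\<close> is $v_j$, and \<open>U l x\<close> is the vertex \<open>x\<close> of the copy of \<open>G2\<close> with label \<open>l\<close>.\<close>

datatype vertex = V nat | U label "nat \<times> nat"

abbreviation u1 :: "label \<Rightarrow> vertex" where
  "u1 l \<equiv> U l (1, 1)"

definition G3 :: "vertex graph" where
  "G3 = Graph (V ` {1..13} \<union> (\<Union>l. U l ` verts G2))
     ((\<Union>l. (\<lambda>e. U l ` e) ` edges G2) \<union>
      {{V 1, V 2}, {V 1, V 4}, {V 1, V 5}, {V 2, V 3}, {V 2, u1 La},
       {V 4, V 6}, {V 4, V 7}, {V 6, V 7}, {V 6, V 8}, {V 7, V 9}, {V 8, V 9},
       {V 8, u1 Lb}, {V 9, u1 Lc},
       {V 5, V 10}, {V 5, V 11}, {V 10, V 11}, {V 10, V 12}, {V 11, V 13}, {V 12, V 13},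
       {V 12, u1 Ld}, {V 13, u1 Le}})"

end

theory Submission
  imports Defs "HOL-Library.Sublist"
begin

text \<open>A copy of \<open>G1\<close> cannot be coloured with the first four classes, so it contains an edge of the
  fifth, and this edge has distance at most 4 from the edge entering the copy at \<open>1\<close>. In the central
  copy of \<open>G2\<close> the two edges leading downwards and those adjacent to them are thus excluded from
  the fifth class, and \<open>{6, 7}\<close> and \<open>{9, 10}\<close> do not suffice to rescue the first four; so the
  fifth class has an edge at distance at most 3 from the edge entering the copy. Each of the 21 edges
  outside the copies of \<open>G2\<close> is at distance at most 2 from such an entering edge, so none of them is
  in the fifth class; but these 21 edges cannot be coloured with the first four classes either.

  For outerplanarity, the vertices are placed on a parabola in an order in which no two edges cross;
  such an order arises by inserting the order of each attached copy, starting with its vertex \<open>1\<close>,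
  right after the vertex to which the copy is attached.\<close>

section \<open>The fifth colour\<close>

inductive near :: "'a graph \<Rightarrow> nat \<Rightarrow> 'a set \<Rightarrow> 'a set \<Rightarrow> bool" for G where
  refl: "e \<in> edges G \<Longrightarrow> near G 0 e e"
| step: "near G n e f \<Longrightarrow> g \<in> edges G \<Longrightarrow> f \<inter> g \<noteq> {} \<Longrightarrow> near G (Suc n) e g"

lemma near_trans:
  assumes "near G n f g" "near G m e f"
  shows "near G (m + n) e g"
  using assms by (induction rule: near.induct) (auto intro: near.step)

text \<open>Consecutive edges of a \<open>near\<close> chain meet but may coincide, so
  \<open>n\<close> is only an upper bound for the distance. Repetitions are dropped from the walk,
  which therefore has at most \<open>n + 1\<close> entries.\<close>

lemma near_walk:
  assumes "near G n e f"
  shows "\<exists>xs. walk (line_graph G) xs \<and> hd xs = e \<and> last xs = f \<and> length xs \<le> Suc n"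
  using assms
proof (induction rule: near.induct)
  case (refl e)
  then show ?case
    by (intro exI[of _ "[e]"]) (simp add: walk_def line_graph_def)
next
  case (step n e f g)
  then obtain xs where xs: "walk (line_graph G) xs" "hd xs = e" "last xs = f" "length xs \<le> Suc n"
    by blast
  show ?case
  proof (cases "f = g")
    case True
    then show ?thesis using xs by (intro exI[of _ xs]) auto
  next
    case False
    have "f \<in> edges G"
      using step(1) by cases auto
    then have "{f, g} \<in> edges (line_graph G)"
      using step.hyps False by (auto simp: line_graph_def)
    then have "walk (line_graph G) (xs @ [g])"
      using xs step.hyps by (auto simp: walk_def successively_append_iff line_graph_def)
    then show ?thesis
      using xs by (intro exI[of _ "xs @ [g]"]) (auto simp: walk_def)
  qed
qed

text \<open>The packing condition asks for distance at least \<open>S ! i + 1\<close>, so a chain of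
  at most \<open>S ! i\<close> steps cannot join different edges of a class. All later arguments use
  the condition in this form.\<close>

lemma packing_near_eq:
  assumes C: "packing_edge_coloring S G C" and i: "i < length S" "e \<in> C i" "f \<in> C i"
    and n: "near G n e f" "n \<le> S ! i"
  shows "e = f"
proof (rule ccontr)
  assume "e \<noteq> f"
  then have far: "graph_dist (line_graph G) e f \<ge> enat (S ! i + 1)"
    using C i unfolding packing_edge_coloring_def by blast
  obtain xs where xs: "walk (line_graph G) xs" "hd xs = e" "last xs = f" "length xs \<le> Suc n"
    using near_walk[OF n(1)] by blast
  then have "graph_dist (line_graph G) e f \<le> enat (length xs - 1)"
    unfolding graph_dist_def by (intro Inf_lower) blast
  also have "\<dots> \<le> enat n"
    using xs by simp
  finally have "enat (S ! i + 1) \<le> enat n"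
    using far by (rule order_trans[rotated])
  then show False using n(2) by simp
qed

section \<open>Finite patterns with computable neighbourhoods\<close>

fun meets :: "nat \<times> nat \<Rightarrow> nat \<times> nat \<Rightarrow> bool" where
  "meets (a, b) (c, d) \<longleftrightarrow> a = c \<or> a = d \<or> b = c \<or> b = d"

text \<open>For \<open>e\<close> in \<open>E\<close> this is the ball of radius \<open>n\<close>
  around \<open>e\<close>: an edge meets itself, so the layers increase. Edges are pairs rather than
  sets to make evaluation possible.\<close>

fun nbhd :: "(nat \<times> nat) list \<Rightarrow> nat \<Rightarrow> nat \<times> nat \<Rightarrow> (nat \<times> nat) list" where
  "nbhd E 0 e = [e]"
| "nbhd E (Suc n) e = filter (\<lambda>f. list_ex (meets f) (nbhd E n e)) E"

definition img :: "(nat \<Rightarrow> 'a) \<Rightarrow> nat \<times> nat \<Rightarrow> 'a set" where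
  "img \<phi> e = {\<phi> (fst e), \<phi> (snd e)}"

text \<open>Injectivity concerns edges only, and distances may shrink in \<open>G\<close>: what
  matters is that close edges of the pattern stay close and different ones stay different.\<close>

definition embeds :: "(nat \<Rightarrow> 'a) \<Rightarrow> (nat \<times> nat) list \<Rightarrow> 'a graph \<Rightarrow> bool" where
  "embeds \<phi> E G \<longleftrightarrow> inj_on (img \<phi>) (set E) \<and> img \<phi> ` set E \<subseteq> edges G"

text \<open>A map that is injective on vertices keeps different vertex sets apart, so it only
  remains to know that \<open>E\<close> does not list an edge in both directions.\<close>

lemma embedsI:
  assumes \<phi>: "inj_on \<phi> A" and A: "\<forall>(a, b)\<in>set E. a \<in> A \<and> b \<in> A"
    and E: "inj_on (\<lambda>(a, b). {a, b}) (set E)" and G: "\<And>e. e \<in> set E \<Longrightarrow> img \<phi> e \<in> edges G"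
  shows "embeds \<phi> E G"
proof -
  have "e = f" if "e \<in> set E" "f \<in> set E" "img \<phi> e = img \<phi> f" for e f
  proof -
    have "{fst e, snd e} = {fst f, snd f}"
      using that A by (intro inj_on_image_eq_iff[OF \<phi>, THEN iffD1]) (auto simp: img_def)
    then show ?thesis
      using inj_onD[OF E _ that(1,2)] by (simp add: case_prod_beta)
  qed
  then show ?thesis
    using G by (auto simp: embeds_def inj_on_def)
qed

lemma embeds_inj: "embeds \<phi> E G \<Longrightarrow> e \<in> set E \<Longrightarrow> f \<in> set E \<Longrightarrow> img \<phi> e = img \<phi> f \<Longrightarrow> e = f"
  unfolding embeds_def by (blast dest: inj_onD)

lemma embeds_mono: "embeds \<phi> E G \<Longrightarrow> set L \<subseteq> set E \<Longrightarrow> embeds \<phi> L G"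
  by (auto simp: embeds_def intro: inj_on_subset)

lemma nbhd_near:
  assumes "embeds \<phi> E G" "e \<in> set E" "f \<in> set (nbhd E n e)"
  shows "f \<in> set E \<and> near G n (img \<phi> e) (img \<phi> f)"
  using assms(3)
proof (induction n arbitrary: f)
  case 0
  then show ?case using assms by (auto simp: embeds_def intro: near.refl)
next
  case (Suc n)
  then obtain g where g: "f \<in> set E" "g \<in> set (nbhd E n e)" "meets f g"
    by (auto simp: list_ex_iff)
  then have "img \<phi> g \<inter> img \<phi> f \<noteq> {}"
    by (cases "(f, g)" rule: meets.cases) (auto simp: img_def)
  then show ?case
    using Suc.IH[OF g(2)] g(1) assms(1) by (auto simp: embeds_def intro: near.step)
qed

definition disjoint_lists :: "'a list \<Rightarrow> 'a list \<Rightarrow> bool" where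
  "disjoint_lists xs ys \<longleftrightarrow> list_all (\<lambda>x. \<not> List.member ys x) xs"

lemma disjoint_lists_iff: "disjoint_lists xs ys \<longleftrightarrow> set xs \<inter> set ys = {}"
  by (auto simp: disjoint_lists_def list_all_iff)

text \<open>\<open>A\<close>, \<open>B\<close>, \<open>C\<close>, \<open>D\<close> are the four classes built so far; \<open>N\<close> and \<open>M\<close> are the edges at
  distance at most 1 and 2 from \<open>e\<close>. The disjunctions are written with \<open>if\<close> because the simplifier
  evaluates the condition first and so prunes the search.\<close>

fun extends :: "'e list \<Rightarrow> 'e list \<Rightarrow> 'e list \<Rightarrow> 'e list \<Rightarrow> ('e \<times> 'e list \<times> 'e list) list \<Rightarrow> bool" where
  "extends A B C D [] \<longleftrightarrow> True"
| "extends A B C D ((e, N, M) # es) \<longleftrightarrow>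
    (if (if disjoint_lists A N then extends (e # A) B C D es else False) then True
     else if (if disjoint_lists B N then extends A (e # B) C D es else False) then True
     else if (if disjoint_lists C M then extends A B (e # C) D es else False) then True
     else if disjoint_lists D M then extends A B C (e # D) es else False)"

text \<open>The colouring \<open>\<kappa>\<close> guides the search: the branch putting
  \<open>e\<close> into its own class passes the disjointness test and succeeds by induction.
  \<open>X\<close> holds all coloured edges, those already placed and those still to come.\<close>

lemma extendsI:
  fixes \<kappa> :: "'e \<Rightarrow> nat"
  assumes "\<forall>(e, N, M)\<in>set es. \<kappa> e < 4 \<and> e \<in> X"
    and "\<forall>(e, N, M)\<in>set es. \<forall>f\<in>X. f \<noteq> e \<and> \<kappa> f = \<kappa> e \<longrightarrow> (if \<kappa> e < 2 then f \<notin> set N else f \<notin> set M)"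
    and "distinct (map fst es)" "fst ` set es \<inter> (set A \<union> set B \<union> set C \<union> set D) = {}"
    and "set A \<union> set B \<union> set C \<union> set D \<subseteq> X"
    and "\<forall>e\<in>set A. \<kappa> e = 0" "\<forall>e\<in>set B. \<kappa> e = 1" "\<forall>e\<in>set C. \<kappa> e = 2" "\<forall>e\<in>set D. \<kappa> e = 3"
  shows "extends A B C D es"
  using assms
proof (induction A B C D es rule: extends.induct)
  case (2 A B C D e N M es)
  have sep: "e \<notin> set A" "e \<notin> set B" "e \<notin> set C" "e \<notin> set D" "e \<notin> fst ` set es"
    using 2(7,8) by auto
  have free: "\<forall>f\<in>X. f \<noteq> e \<and> \<kappa> f = \<kappa> e \<longrightarrow> (if \<kappa> e < 2 then f \<notin> set N else f \<notin> set M)"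
    using 2(6) by simp
  have "\<kappa> e < 4" using 2(5) by simp
  then consider "\<kappa> e = 0" | "\<kappa> e = 1" | "\<kappa> e = 2" | "\<kappa> e = 3" by linarith
  then show ?case
  proof cases
    case 1
    then have d: "disjoint_lists A N" using free sep 2(9,10) by (force simp: disjoint_lists_iff)
    then have "extends (e # A) B C D es"
      using 2(5-13) 1 by (intro 2(1)) (auto simp del: extends.simps)
    with d show ?thesis by simp
  next
    case p: 2
    then have d: "disjoint_lists B N" using free sep 2(9,11) by (force simp: disjoint_lists_iff)
    \<comment> \<open>The induction hypothesis for a later branch presupposes that the earlier ones
      fail; if one of them succeeds, the search has succeeded anyway.\<close>
    have "extends A (e # B) C D es" if "\<not> (if disjoint_lists A N then extends (e # A) B C D es else False)"
      using 2(5-13) p d that by (intro 2(2)) (auto simp del: extends.simps)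
    with d show ?thesis by auto
  next
    case p: 3
    then have d: "disjoint_lists C M" using free sep 2(9,12) by (force simp: disjoint_lists_iff)
    have "extends A B (e # C) D es" if "\<not> (if disjoint_lists A N then extends (e # A) B C D es else False)"
      "\<not> (if disjoint_lists B N then extends A (e # B) C D es else False)"
      using 2(5-13) p d that by (intro 2(3)) (auto simp del: extends.simps)
    with d show ?thesis by auto
  next
    case p: 4
    then have d: "disjoint_lists D M" using free sep 2(9,13) by (force simp: disjoint_lists_iff)
    have "extends A B C (e # D) es" if "\<not> (if disjoint_lists A N then extends (e # A) B C D es else False)"
      "\<not> (if disjoint_lists B N then extends A (e # B) C D es else False)"
      "\<not> (if disjoint_lists C M then extends A B (e # C) D es else False)"
      using 2(5-13) p d that by (intro 2(4)) (auto simp del: extends.simps)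
    with d show ?thesis by auto
  qed
qed simp

text \<open>Neighbourhoods are taken in \<open>E\<close> rather than in \<open>L\<close>, because an
  edge that is not to be coloured still shortens distances.\<close>

definition table ::
    "(nat \<times> nat) list \<Rightarrow> (nat \<times> nat) list \<Rightarrow>
     ((nat \<times> nat) \<times> (nat \<times> nat) list \<times> (nat \<times> nat) list) list" where
  "table E L = map (\<lambda>e. (e, nbhd E 1 e, nbhd E 2 e)) L"

text \<open>The fifth class has index 4, so every edge of \<open>L\<close> has a colour below 4.
  Closeness in the pattern carries over to \<open>G\<close>, where the entries 1, 1, 2, 2 forbid
  equal colours within radius 1 for the first two classes and radius 2 for the next two.\<close>

lemma packing_extends:
  assumes C: "packing_edge_coloring [1, 1, 2, 2, 5] G C" and E: "embeds \<phi> E G"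
    and L: "set L \<subseteq> set E" "distinct L" "\<forall>e\<in>set L. img \<phi> e \<notin> C 4"
  shows "extends [] [] [] [] (table E L)"
proof -
  have "\<exists>i<4. img \<phi> e \<in> C i" if "e \<in> set L" for e
  proof -
    have "(\<Union>i<5. C i) = edges G"
      using C by (simp add: packing_edge_coloring_def eval_nat_numeral)
    moreover have "img \<phi> e \<in> edges G"
      using E L(1) that by (auto simp: embeds_def)
    ultimately obtain i where "i < 5" "img \<phi> e \<in> C i" by blast
    then show ?thesis
      using L(3) that by (intro exI[of _ i]) (cases "i = 4"; auto)
  qed
  then obtain \<kappa> where \<kappa>: "\<And>e. e \<in> set L \<Longrightarrow> \<kappa> e < 4 \<and> img \<phi> e \<in> C (\<kappa> e)"
    by metis
  have near: "f = e" if "e \<in> set L" "f \<in> set L" "\<kappa> f = \<kappa> e" "f \<in> set (nbhd E n e)"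
    "n \<le> [1, 1, 2, 2, 5] ! \<kappa> e" for e f n
  proof -
    have "near G n (img \<phi> e) (img \<phi> f)"
      using nbhd_near[OF E _ that(4)] that L by blast
    then have "img \<phi> e = img \<phi> f"
      using \<kappa>[OF that(1)] \<kappa>[OF that(2)] that by (intro packing_near_eq[OF C]) auto
    then show ?thesis
      using embeds_inj[OF E, of f e] L(1) that(1,2) by auto
  qed
  have "f \<notin> set (nbhd E 1 e)" if "e \<in> set L" "f \<in> set L" "f \<noteq> e" "\<kappa> f = \<kappa> e" "\<kappa> e < 2" for e f
    using near[OF that(1,2,4), of 1] that(3,5) by (auto simp: less_2_cases_iff)
  moreover have "f \<notin> set (nbhd E 2 e)"
    if "e \<in> set L" "f \<in> set L" "f \<noteq> e" "\<kappa> f = \<kappa> e" "\<not> \<kappa> e < 2" for e f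
  proof -
    have "\<kappa> e = 2 \<or> \<kappa> e = 3" using \<kappa>[OF that(1)] that(5) by auto
    then show ?thesis using near[OF that(1,2,4), of 2] that(3) by auto
  qed
  ultimately show ?thesis
    using \<kappa> L(2) by (intro extendsI[where \<kappa> = \<kappa> and X = "set L"]) (auto simp: table_def comp_def)
qed

text \<open>The lists are ordered so that the search for a colouring fails early. The vertices 12, 13, 14
  are the outer ends of the edges leaving a copy of \<open>G1\<close>, and 14 to 18 in \<open>head_edges\<close> stand for
  $u_{1a}, \dots, u_{1e}$.\<close>

definition G1_edges :: "(nat \<times> nat) list" where
  "G1_edges = [(6, 7), (6, 8), (2, 6), (7, 8), (3, 7), (2, 3), (3, 4), (1, 2), (4, 5), (5, 1),
     (4, 10), (5, 9), (10, 11), (9, 10), (9, 11)]"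

definition G1_pendant_edges :: "(nat \<times> nat) list" where
  "G1_pendant_edges = [(10, 11), (9, 11), (9, 10), (5, 9), (4, 10), (4, 5), (5, 1), (3, 4), (2, 3),
     (1, 2), (1, 12), (2, 6), (3, 7), (6, 7), (7, 8), (6, 8), (8, 13), (11, 14)]"

definition head_edges :: "(nat \<times> nat) list" where
  "head_edges = [(6, 7), (7, 9), (4, 7), (4, 6), (6, 8), (8, 9), (9, 16), (8, 15), (1, 4), (1, 2),
     (1, 5), (5, 11), (5, 10), (10, 11), (11, 13), (10, 12), (12, 13), (13, 18), (12, 17), (2, 3),
     (2, 14)]"

section \<open>Four classes fail on the patterns\<close>

lemma not_extends_G1: "\<not> extends [] [] [] [] (table G1_edges G1_edges)"
  by code_simp

text \<open>Here \<open>(6, 7)\<close> is the one edge handed to the fifth class, while the entering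
  edge and the two leaving edges have to be coloured too.\<close>

lemma not_extends_6_7:
  "\<not> extends [] [] [] [] (table G1_pendant_edges (filter (\<lambda>e. e \<noteq> (6, 7)) G1_pendant_edges))"
  by code_simp

lemma not_extends_9_10:
  "\<not> extends [] [] [] [] (table G1_pendant_edges (filter (\<lambda>e. e \<noteq> (9, 10)) G1_pendant_edges))"
  by code_simp

lemma not_extends_head: "\<not> extends [] [] [] [] (table head_edges head_edges)"
  by code_simp

lemma class5_G1:
  assumes "packing_edge_coloring [1, 1, 2, 2, 5] G C" "embeds \<phi> G1_edges G"
  shows "\<exists>e\<in>set G1_edges. img \<phi> e \<in> C 4"
  using packing_extends[OF assms order_refl] not_extends_G1 by (auto simp: G1_edges_def)

lemma class5_G1_pendant:
  assumes "packing_edge_coloring [1, 1, 2, 2, 5] G C" "embeds \<phi> G1_pendant_edges G"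
    and "d = (6, 7) \<or> d = (9, 10)"
  shows "\<exists>e\<in>set G1_pendant_edges. e \<noteq> d \<and> img \<phi> e \<in> C 4"
proof (rule ccontr)
  assume *: "\<not> ?thesis"
  have "distinct (filter (\<lambda>e. e \<noteq> d) G1_pendant_edges)"
    by (intro distinct_filter) (simp add: G1_pendant_edges_def)
  then have "extends [] [] [] [] (table G1_pendant_edges (filter (\<lambda>e. e \<noteq> d) G1_pendant_edges))"
    using * by (intro packing_extends[OF assms(1,2)]) auto
  then show False
    using assms(3) not_extends_6_7 not_extends_9_10 by auto
qed

lemma class5_head:
  assumes "packing_edge_coloring [1, 1, 2, 2, 5] G C" "embeds \<phi> head_edges G"
  shows "\<exists>e\<in>set head_edges. img \<phi> e \<in> C 4"
  using packing_extends[OF assms order_refl] not_extends_head by (auto simp: head_edges_def)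

section \<open>Locating the fifth class in a copy of \<open>G1\<close>\<close>

text \<open>The edges farthest from the entering edge \<open>(1, 12)\<close> are
  \<open>(7, 8)\<close> and \<open>(10, 11)\<close>, at distance 4. The last conjunct serves to tell
  the edge found apart from the edges around the central copy.\<close>

lemma class5_G1_child:
  assumes "packing_edge_coloring [1, 1, 2, 2, 5] G C" "embeds \<phi> ((1, 12) # G1_edges) G"
  shows "\<exists>e. e \<in> C 4 \<and> e \<noteq> img \<phi> (1, 12) \<and> near G 4 (img \<phi> (1, 12)) e \<and> e \<subseteq> \<phi> ` {1..11}"
proof -
  have "embeds \<phi> G1_edges G"
    using assms(2) by (rule embeds_mono) auto
  then obtain e where e: "e \<in> set G1_edges" "img \<phi> e \<in> C 4"
    using class5_G1[OF assms(1)] by blast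
  have "\<forall>e\<in>set G1_edges. e \<in> set (nbhd ((1, 12) # G1_edges) 4 (1, 12)) \<and> e \<noteq> (1, 12)
      \<and> {fst e, snd e} \<subseteq> {1..11}"
    by code_simp
  then have "e \<in> set (nbhd ((1, 12) # G1_edges) 4 (1, 12))" "e \<noteq> (1, 12)" "{fst e, snd e} \<subseteq> {1..11}"
    using e by blast+
  moreover from this have "near G 4 (img \<phi> (1, 12)) (img \<phi> e)"
    by (intro nbhd_near[OF assms(2), THEN conjunct2]) auto
  moreover have "img \<phi> e \<noteq> img \<phi> (1, 12)"
    using embeds_inj[OF assms(2), of e "(1, 12)"] e(1) calculation(2) by auto
  moreover have "img \<phi> e \<subseteq> \<phi> ` {1..11}"
    using calculation(3) by (auto simp: img_def)
  ultimately show ?thesis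
    using e by blast
qed

lemma class5_G1_parent:
  assumes C: "packing_edge_coloring [1, 1, 2, 2, 5] G C" and \<phi>: "embeds \<phi> G1_pendant_edges G"
    and f: "f \<in> C 4" "near G 4 (img \<phi> (8, 13)) f" "f \<notin> img \<phi> ` set G1_pendant_edges"
    and g: "g \<in> C 4" "near G 4 (img \<phi> (11, 14)) g" "g \<notin> img \<phi> ` set G1_pendant_edges"
  shows "\<exists>e\<in>set G1_edges. img \<phi> e \<in> C 4 \<and> near G 3 (img \<phi> (1, 12)) (img \<phi> e)"
proof -
  let ?E = "G1_pendant_edges"
  have eq: "e = d" if "e \<in> set ?E" "d \<in> set ?E" "img \<phi> e \<in> C 4" "img \<phi> d \<in> C 4" "d \<in> set (nbhd ?E n e)"
    "n \<le> 5" for e d n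
  proof -
    have "img \<phi> e = img \<phi> d"
      using nbhd_near[OF \<phi> that(1,5)] that by (intro packing_near_eq[OF C, of 4]) auto
    then show ?thesis
      using embeds_inj[OF \<phi>] that by blast
  qed
  \<comment> \<open>The two leaving edges and the edges adjacent to them. Each is within distance 1
    of a leaving edge, hence within 1 + 4 = 5 of \<open>f\<close> or \<open>g\<close>, and so cannot
    be in the fifth class.\<close>
  let ?B = "[(6, 8), (7, 8), (8, 13), (9, 11), (10, 11), (11, 14)]"
  have far: "img \<phi> e \<notin> C 4" if e: "e \<in> set ?B" for e
  proof
    have "\<forall>e\<in>set ?B. e \<in> set ?E \<and> ((8, 13) \<in> set (nbhd ?E 1 e) \<or> (11, 14) \<in> set (nbhd ?E 1 e))"
      by code_simp
    then have e: "e \<in> set ?E" "(8, 13) \<in> set (nbhd ?E 1 e) \<or> (11, 14) \<in> set (nbhd ?E 1 e)"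
      using e by blast+
    assume 4: "img \<phi> e \<in> C 4"
    from e(2) show False
    proof
      assume "(8, 13) \<in> set (nbhd ?E 1 e)"
      then have "near G (1 + 4) (img \<phi> e) f"
        using nbhd_near[OF \<phi> e(1)] by (intro near_trans[OF f(2)]) auto
      then have "img \<phi> e = f"
        using 4 f by (intro packing_near_eq[OF C, of 4]) auto
      then show False using f(3) e(1) by blast
    next
      assume "(11, 14) \<in> set (nbhd ?E 1 e)"
      then have "near G (1 + 4) (img \<phi> e) g"
        using nbhd_near[OF \<phi> e(1)] by (intro near_trans[OF g(2)]) auto
      then have "img \<phi> e = g"
        using 4 g by (intro packing_near_eq[OF C, of 4]) auto
      then show False using g(3) e(1) by blast
    qed
  qed
  have sub: "set G1_edges \<subseteq> set ?E"
    by (simp add: G1_edges_def G1_pendant_edges_def)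
  then obtain d where d: "d \<in> set G1_edges" "img \<phi> d \<in> C 4"
    using class5_G1[OF C embeds_mono[OF \<phi>]] by blast
  obtain e1 where e1: "e1 \<in> set ?E" "e1 \<noteq> (6, 7)" "img \<phi> e1 \<in> C 4"
    using class5_G1_pendant[OF C \<phi>] by blast
  obtain e2 where e2: "e2 \<in> set ?E" "e2 \<noteq> (9, 10)" "img \<phi> e2 \<in> C 4"
    using class5_G1_pendant[OF C \<phi>] by blast
  \<comment> \<open>Outside \<open>?B\<close> every pattern edge is within distance 5 of any edge of
    the copy. So \<open>d\<close> is the only pattern edge in the fifth class, and \<open>e1\<close>
    and \<open>e2\<close> coincide with it.\<close>
  have "\<forall>d\<in>set G1_edges. set (filter (\<lambda>e. e \<notin> set ?B) ?E) \<subseteq> set (nbhd ?E 5 d)"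
    by code_simp
  then have "d = e" if "e \<in> set ?E" "img \<phi> e \<in> C 4" for e
    using eq[of d e 5] far[of e] d sub that by auto
  then have "d = e1" "d = e2"
    using e1 e2 by blast+
  then have "d \<noteq> (6, 7)" "d \<noteq> (9, 10)" "d \<notin> set ?B"
    using e1(2) e2(2) far[of d] d(2) by blast+
  \<comment> \<open>The edges of the copy at distance 4 from the entering edge,
    \<open>(7, 8)\<close> and \<open>(10, 11)\<close>, are in \<open>?B\<close>.\<close>
  moreover have "set (filter (\<lambda>d. d \<notin> set ((6, 7) # (9, 10) # ?B)) G1_edges) \<subseteq> set (nbhd ?E 3 (1, 12))"
    by code_simp
  ultimately have "d \<in> set (nbhd ?E 3 (1, 12))"
    using d(1) by auto
  then have "near G 3 (img \<phi> (1, 12)) (img \<phi> d)"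
    by (intro nbhd_near[OF \<phi>, THEN conjunct2]) (simp add: G1_pendant_edges_def)
  then show ?thesis
    using d by blast
qed

section \<open>Embedding the patterns into \<open>G3\<close>\<close>

lemma image_edges_G3: "e \<in> edges G2 \<Longrightarrow> U l ` e \<in> edges G3"
  unfolding G3_def graph.sel by (intro UnI1 UN_I[of l] imageI UNIV_I)

lemma edges_copy:
  assumes "{a, b} \<in> edges G1" "c \<in> {1..7}"
  shows "{U l (c, a), U l (c, b)} \<in> edges G3"
proof -
  have "Pair c ` {a, b} \<in> edges G2"
    unfolding G2_def graph.sel using assms by (intro UnI1 UN_I[of c] imageI)
  from image_edges_G3[OF this, of l] show ?thesis by simp
qed

lemma edges_link:
  "{U l (1, 8), U l (2, 1)} \<in> edges G3" "{U l (1, 11), U l (3, 1)} \<in> edges G3"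
proof -
  have "{(1, 8), (2, 1)} \<in> edges G2" "{(1, 11), (3, 1)} \<in> edges G2"
    unfolding G2_def graph.sel by blast+
  from this[THEN image_edges_G3, of l] show "{U l (1, 8), U l (2, 1)} \<in> edges G3"
    "{U l (1, 11), U l (3, 1)} \<in> edges G3"
    by simp_all
qed

lemma G1_edges_G1: "e \<in> set G1_edges \<Longrightarrow> {fst e, snd e} \<in> edges G1"
  unfolding G1_edges_def G1_def by (simp, elim disjE; simp)

text \<open>\<open>x\<close> is the outer end of the edge entering copy \<open>c\<close>. The values
  at 13 and 14 are the vertices below the central copy, so they are meant for
  \<open>c = 1\<close>.\<close>

definition copy_vertex :: "label \<Rightarrow> nat \<Rightarrow> vertex \<Rightarrow> nat \<Rightarrow> vertex" where
  "copy_vertex l c x i =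
     (if i = 12 then x else if i = 13 then U l (2, 1) else if i = 14 then U l (3, 1) else U l (c, i))"

lemma embeds_child:
  assumes "c = 2 \<and> x = U l (1, 8) \<or> c = 3 \<and> x = U l (1, 11)"
  shows "embeds (copy_vertex l c x) ((1, 12) # G1_edges) G3"
proof (rule embedsI[where A = "{1..12}"])
  show "inj_on (copy_vertex l c x) {1..12}"
    using assms by (auto simp: inj_on_def copy_vertex_def)
  show "\<forall>(a, b)\<in>set ((1, 12) # G1_edges). a \<in> {1..12} \<and> b \<in> {1..12}"
    by (simp add: G1_edges_def)
  show "inj_on (\<lambda>(a, b). {a, b}) (set ((1, 12) # G1_edges))"
    by (simp add: G1_edges_def doubleton_eq_iff)
  fix e assume "e \<in> set ((1, 12) # G1_edges)"
  moreover have "\<forall>e\<in>set G1_edges. fst e \<le> 11 \<and> snd e \<le> 11"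
    by (simp add: G1_edges_def)
  ultimately consider "e = (1, 12)" | "e \<in> set G1_edges" "fst e \<le> 11" "snd e \<le> 11"
    by auto
  then show "img (copy_vertex l c x) e \<in> edges G3"
  proof cases
    case 1
    have "{x, U l (c, 1)} \<in> edges G3"
      using assms edges_link[of l] by blast
    with 1 show ?thesis
      by (simp add: img_def copy_vertex_def insert_commute)
  next
    case 2
    moreover have "c \<in> {1..7}"
      using assms by auto
    ultimately show ?thesis
      using edges_copy[OF G1_edges_G1, of e c l] by (simp add: img_def copy_vertex_def)
  qed
qed

lemma embeds_parent:
  assumes x: "{V k, U l (1, 1)} \<in> edges G3"
  shows "embeds (copy_vertex l 1 (V k)) G1_pendant_edges G3"
proof (rule embedsI[where A = "{1..14}"])
  show "inj_on (copy_vertex l 1 (V k)) {1..14}"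
    by (auto simp: inj_on_def copy_vertex_def)
  show "\<forall>(a, b)\<in>set G1_pendant_edges. a \<in> {1..14} \<and> b \<in> {1..14}"
    by (simp add: G1_pendant_edges_def)
  show "inj_on (\<lambda>(a, b). {a, b}) (set G1_pendant_edges)"
    by (simp add: G1_pendant_edges_def doubleton_eq_iff)
  fix e assume "e \<in> set G1_pendant_edges"
  moreover have "\<forall>e\<in>set G1_edges. fst e \<le> 11 \<and> snd e \<le> 11"
    by (simp add: G1_edges_def)
  moreover have "\<forall>e\<in>set G1_pendant_edges. e = (1, 12) \<or> e = (8, 13) \<or> e = (11, 14) \<or> e \<in> set G1_edges"
    by (simp add: G1_edges_def G1_pendant_edges_def)
  ultimately consider "e = (1, 12)" | "e = (8, 13)" | "e = (11, 14)"
    | "e \<in> set G1_edges" "fst e \<le> 11" "snd e \<le> 11"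
    by blast
  then show "img (copy_vertex l 1 (V k)) e \<in> edges G3"
  proof cases
    case 4
    then show ?thesis
      using edges_copy[OF G1_edges_G1, of e 1 l] by (simp add: img_def copy_vertex_def)
  next
    case 1
    then show ?thesis using x by (simp add: img_def copy_vertex_def insert_commute)
  next
    case 2
    then show ?thesis using edges_link(1)[of l] by (simp add: img_def copy_vertex_def)
  next
    case 3
    then show ?thesis using edges_link(2)[of l] by (simp add: img_def copy_vertex_def)
  qed
qed

text \<open>The copies 2 and 3 supply the two edges that \<open>class5_G1_parent\<close> asks for,
  since the edges leaving the central copy are the ones entering them. The inclusion in
  \<open>range (U l)\<close> will separate \<open>e\<close> from the edges outside the copies of
  \<open>G2\<close>.\<close>

lemma class5_near_root:
  assumes C: "packing_edge_coloring [1, 1, 2, 2, 5] G3 C" and x: "{V k, U l (1, 1)} \<in> edges G3"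
  shows "\<exists>e. e \<in> C 4 \<and> near G3 3 {V k, U l (1, 1)} e \<and> e \<subseteq> range (U l)"
proof -
  let ?\<phi> = "copy_vertex l 1 (V k)"
  have child: "\<exists>e. e \<in> C 4 \<and> near G3 4 {U l (c, 1), x} e \<and> e \<notin> img ?\<phi> ` set G1_pendant_edges"
    if c: "c = 2 \<and> x = U l (1, 8) \<or> c = 3 \<and> x = U l (1, 11)" for c x
  proof -
    have "img (copy_vertex l c x) (1, 12) = {U l (c, 1), x}"
      by (simp add: img_def copy_vertex_def)
    moreover have "copy_vertex l c x ` {1..11} = (\<lambda>i. U l (c, i)) ` {1..11}"
      by (intro image_cong) (auto simp: copy_vertex_def)
    ultimately obtain e where e: "e \<in> C 4" "near G3 4 {U l (c, 1), x} e"
      "e \<subseteq> (\<lambda>i. U l (c, i)) ` {1..11}"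
      using class5_G1_child[OF C embeds_child[OF c]] by auto
    \<comment> \<open>The outer ends 12, 13, 14 occur only as second components, so every pattern
      edge has its first end in the central copy, whereas \<open>e\<close> lies in copy 2 or
      3.\<close>
    have in_img: "U l (1, fst d) \<in> img ?\<phi> d" if "d \<in> set G1_pendant_edges" for d
    proof -
      have "\<forall>e\<in>set G1_pendant_edges. fst e \<le> 11"
        by (simp add: G1_pendant_edges_def)
      then have "fst d \<le> 11"
        using that by blast
      then show ?thesis
        by (simp add: img_def copy_vertex_def)
    qed
    have "c \<noteq> 1"
      using c by auto
    then have "U l (1, i) \<notin> e" for i
      using e(3) by auto
    then have "e \<notin> img ?\<phi> ` set G1_pendant_edges"
      using in_img by blast
    with e show ?thesis
      by blast
  qed
  have \<phi>: "img ?\<phi> (8, 13) = {U l (2, 1), U l (1, 8)}" "img ?\<phi> (11, 14) = {U l (3, 1), U l (1, 11)}"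
    "img ?\<phi> (1, 12) = {V k, U l (1, 1)}"
    by (auto simp: img_def copy_vertex_def)
  obtain f where f: "f \<in> C 4" "near G3 4 (img ?\<phi> (8, 13)) f" "f \<notin> img ?\<phi> ` set G1_pendant_edges"
    using child[of 2 "U l (1, 8)"] unfolding \<phi> by blast
  obtain g where g: "g \<in> C 4" "near G3 4 (img ?\<phi> (11, 14)) g" "g \<notin> img ?\<phi> ` set G1_pendant_edges"
    using child[of 3 "U l (1, 11)"] unfolding \<phi> by blast
  obtain e where e: "e \<in> set G1_edges" "img ?\<phi> e \<in> C 4" "near G3 3 (img ?\<phi> (1, 12)) (img ?\<phi> e)"
    using class5_G1_parent[OF C embeds_parent[OF x] f g] by blast
  moreover have "\<forall>e\<in>set G1_edges. fst e \<le> 11 \<and> snd e \<le> 11"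
    by (simp add: G1_edges_def)
  then have "img ?\<phi> e \<subseteq> range (U l)"
    using e(1) by (auto simp: img_def copy_vertex_def)
  ultimately show ?thesis
    unfolding \<phi> by blast
qed

definition head_vertex :: "nat \<Rightarrow> vertex" where
  "head_vertex i =
    (if i \<le> 13 then V i else u1 ([La, Lb, Lc, Ld, Le] ! (i - 14)))"

lemma embeds_head: "embeds head_vertex head_edges G3"
proof (rule embedsI[where A = "{1..18}"])
  have "i = j" if "14 \<le> i" "14 \<le> j" "i \<le> 18" "j \<le> 18"
    "[La, Lb, Lc, Ld, Le] ! (i - 14) = [La, Lb, Lc, Ld, Le] ! (j - 14)" for i j :: nat
  proof -
    have "i - 14 = j - 14"
      using that by (subst nth_eq_iff_index_eq[symmetric, of "[La, Lb, Lc, Ld, Le]"]) auto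
    then show ?thesis using that by auto
  qed
  then show "inj_on head_vertex {1..18}"
    by (auto simp: inj_on_def head_vertex_def)
  show "\<forall>(a, b)\<in>set head_edges. a \<in> {1..18} \<and> b \<in> {1..18}"
    by (simp add: head_edges_def)
  show "inj_on (\<lambda>(a, b). {a, b}) (set head_edges)"
    by (simp add: head_edges_def doubleton_eq_iff)
  fix e assume "e \<in> set head_edges"
  then show "img head_vertex e \<in> edges G3"
    unfolding head_edges_def G3_def
    by (simp, elim disjE; simp add: img_def head_vertex_def doubleton_eq_iff)
qed

lemma no_packing_G3: "\<not> packing_edge_coloring [1, 1, 2, 2, 5] G3 C"
proof
  assume C: "packing_edge_coloring [1, 1, 2, 2, 5] G3 C"
  obtain e where e: "e \<in> set head_edges" "img head_vertex e \<in> C 4"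
    using class5_head[OF C embeds_head] by blast
  \<comment> \<open>Distance 2 to an entering edge and 3 from there to a fifth-class edge
    \<open>h\<close> add up to 5, which forces \<open>h\<close> to be the image of \<open>e\<close>.
    But that image has an end of the form \<open>V k\<close>, and \<open>h\<close> lies inside a
    copy of \<open>G2\<close>.\<close>
  have E: "\<forall>e\<in>set head_edges. fst e \<le> 13 \<and>
      (\<exists>d\<in>set (nbhd head_edges 2 e). d \<in> set [(2, 14), (8, 15), (9, 16), (12, 17), (13, 18)])"
    by code_simp
  from E obtain d where d: "d \<in> set [(2, 14), (8, 15), (9, 16), (12, 17), (13, 18)]"
    "d \<in> set (nbhd head_edges 2 e)" and V: "fst e \<le> 13"
    using e by blast
  have near: "near G3 2 (img head_vertex e) (img head_vertex d)" and "d \<in> set head_edges"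
    using nbhd_near[OF embeds_head e(1) d(2)] by auto
  then have "img head_vertex d \<in> edges G3"
    using embeds_head by (auto simp: embeds_def)
  moreover obtain k l where kl: "img head_vertex d = {V k, u1 l}"
    using d(1) by (auto simp: img_def head_vertex_def doubleton_eq_iff)
  ultimately obtain h where h: "h \<in> C 4" "near G3 3 {V k, u1 l} h" "h \<subseteq> range (U l)"
    using class5_near_root[OF C, of k l] by auto
  have "near G3 5 (img head_vertex e) h"
    using near_trans[OF h(2), of 2 "img head_vertex e"] near kl by simp
  then have "img head_vertex e = h"
    using e h by (intro packing_near_eq[OF C, of 4]) auto
  moreover have "V (fst e) \<in> img head_vertex e"
    using V by (auto simp: img_def head_vertex_def)
  ultimately show False
    using h(3) by auto
qed

section \<open>Outerplanarity\<close>

definition parab :: "real \<Rightarrow> complex" where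
  "parab x = Complex x (x\<^sup>2)"

lemma parab_eq_iff [simp]: "parab x = parab y \<longleftrightarrow> x = y"
  by (auto simp: parab_def)

text \<open>The affine function \<open>Im z - (s + t) * Re z + s * t\<close> has the value
  \<open>(x - s) * (x - t)\<close> at \<open>parab x\<close>, so along a chord it interpolates
  between two such products. The facts below follow by choosing \<open>s\<close> and
  \<open>t\<close>.\<close>

lemma in_chord:
  assumes "z \<in> closed_segment (parab x) (parab y)"
  obtains u where "0 \<le> u" "u \<le> 1" "z = (1 - u) *\<^sub>R parab x + u *\<^sub>R parab y"
    "\<And>s t. Im z - (s + t) * Re z + s * t = (1 - u) * ((x - s) * (x - t)) + u * ((y - s) * (y - t))"
proof -
  obtain u where "0 \<le> u" "u \<le> 1" "z = (1 - u) *\<^sub>R parab x + u *\<^sub>R parab y"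
    using assms unfolding closed_segment_def by blast
  moreover from this have eq: "Re z = (1 - u) * x + u * y" "Im z = (1 - u) * x\<^sup>2 + u * y\<^sup>2"
    by (simp_all add: parab_def)
  have "Im z - (s + t) * Re z + s * t = (1 - u) * ((x - s) * (x - t)) + u * ((y - s) * (y - t))" for s t
    unfolding eq by (simp add: algebra_simps power2_eq_square)
  ultimately show thesis
    by (rule that)
qed

lemma parab_in_chord:
  assumes "parab v \<in> closed_segment (parab x) (parab y)"
  shows "v = x \<or> v = y"
proof -
  have "Im (parab v) - (x + y) * Re (parab v) + x * y = 0"
    using assms by (rule in_chord) simp
  then have "(v - x) * (v - y) = 0"
    by (simp add: parab_def algebra_simps power2_eq_square)
  then show ?thesis by simp
qed

lemma chord_above:
  assumes "z \<in> closed_segment (parab x) (parab y)"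
  shows "(Re z)\<^sup>2 \<le> Im z"
proof -
  obtain u where u: "0 \<le> u" "u \<le> 1" and *: "\<And>s t. Im z - (s + t) * Re z + s * t
      = (1 - u) * ((x - s) * (x - t)) + u * ((y - s) * (y - t))"
    using assms by (rule in_chord) blast
  \<comment> \<open>For \<open>s = t = Re z\<close> the products are squares and the affine function
    takes the value \<open>Im z - (Re z)\<^sup>2\<close> at \<open>z\<close>.\<close>
  have "0 \<le> (1 - u) * ((x - Re z) * (x - Re z)) + u * ((y - Re z) * (y - Re z))"
    using u by simp
  also have "\<dots> = Im z - (Re z)\<^sup>2"
    using *[of "Re z" "Re z"] by (simp add: algebra_simps power2_eq_square)
  finally show ?thesis by simp
qed

text \<open>The quadratic \<open>(t - x) * (t - y)\<close> is the restriction to the parabola of an affine function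
  vanishing on the chord from \<open>x\<close> to \<open>y\<close>; if the two chords do not cross, it does not change sign
  between \<open>x'\<close> and \<open>y'\<close>.\<close>

lemma chords_inter:
  assumes "x < y" "x' < y'" "(x, y) \<noteq> (x', y')"
    and nc: "\<not> (x < x' \<and> x' < y \<and> y < y')" "\<not> (x' < x \<and> x < y' \<and> y' < y)"
    and z: "z \<in> closed_segment (parab x) (parab y)" "z \<in> closed_segment (parab x') (parab y')"
  shows "\<exists>w. z = parab w \<and> w \<in> {x, y} \<inter> {x', y'}"
proof -
  let ?A = "(x' - x) * (x' - y)" and ?B = "(y' - x) * (y' - y)"
  have "Im z - (x + y) * Re z + x * y = 0"
    using z(1) by (rule in_chord) simp
  moreover obtain u where u: "0 \<le> u" "u \<le> 1" and zu: "z = (1 - u) *\<^sub>R parab x' + u *\<^sub>R parab y'"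
    and *: "\<And>s t. Im z - (s + t) * Re z + s * t
      = (1 - u) * ((x' - s) * (x' - t)) + u * ((y' - s) * (y' - t))"
    using z(2) by (rule in_chord) blast
  ultimately have sum: "(1 - u) * ?A + u * ?B = 0"
    by simp
  have "?A \<le> 0 \<and> ?B \<le> 0 \<or> ?A \<ge> 0 \<and> ?B \<ge> 0"
    unfolding mult_le_0_iff zero_le_mult_iff using assms(1,2) nc by auto
  then have "(1 - u) * ?A \<le> 0 \<and> u * ?B \<le> 0 \<or> (1 - u) * ?A \<ge> 0 \<and> u * ?B \<ge> 0"
    using u by (auto simp: mult_nonneg_nonneg mult_nonneg_nonpos)
  then have "(1 - u) * ?A = 0" "u * ?B = 0"
    using sum by linarith+
  then have A: "u = 1 \<or> x' = x \<or> x' = y" and B: "u = 0 \<or> y' = x \<or> y' = y"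
    by auto
  \<comment> \<open>If \<open>z\<close> is inside the second chord, both ends of that chord are ends
    of the first, and the chords coincide against the assumption. Otherwise \<open>z\<close> is an
    end of the second chord, and shared.\<close>
  consider "u = 0" | "u = 1" | "u \<noteq> 0" "u \<noteq> 1" by blast
  then show ?thesis
  proof cases
    case 3
    then show ?thesis using A B assms(1-3) by auto
  qed (use zu A B in auto)
qed

text \<open>The vertical ray from \<open>z\<close> downwards is connected, unbounded and misses
  \<open>D\<close>.\<close>

lemma below_parab_in_outside:
  assumes D: "\<And>w. w \<in> D \<Longrightarrow> (Re w)\<^sup>2 \<le> Im w" and z: "Im z < (Re z)\<^sup>2"
  shows "z \<in> outside D"
proof -
  let ?r = "(\<lambda>t. Complex (Re z) t) ` {..Im z}"
  have "connected ?r"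
  proof (intro connected_continuous_image)
    show "continuous_on {..Im z} (\<lambda>t. Complex (Re z) t)"
      unfolding complex_eq by (intro continuous_intros)
  qed simp
  moreover have "?r \<subseteq> - D"
    using D z by fastforce
  moreover have "z \<in> ?r"
    by (intro image_eqI[of _ _ "Im z"]) auto
  ultimately have sub: "?r \<subseteq> connected_component_set (- D) z"
    by (intro connected_component_maximal)
  have "\<not> bounded ?r"
  proof
    assume "bounded ?r"
    then have "bounded (Im ` ?r)"
      by (rule bounded_linear_image) (rule bounded_linear_Im)
    then have "bounded {..Im z}"
      by (simp add: image_image)
    then have "bdd_below {..Im z}"
      by (rule bounded_imp_bdd_below)
    then obtain m where "\<forall>t\<le>Im z. m \<le> t"
      by (auto simp: bdd_below_def)
    from this[THEN spec, of "min (Im z) (m - 1)"] show False by simp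
  qed
  then show ?thesis
    using sub bounded_subset[OF _ sub] D[of z] z by (auto simp: outside_def)
qed

text \<open>The points straight below \<open>parab x\<close> are in the outside and converge to it,
  while \<open>parab x\<close> itself belongs to \<open>D\<close>.\<close>

lemma parab_in_frontier_outside:
  assumes D: "\<And>w. w \<in> D \<Longrightarrow> (Re w)\<^sup>2 \<le> Im w" and x: "parab x \<in> D"
  shows "parab x \<in> frontier (outside D)"
proof -
  have "(\<lambda>n. parab x - \<i> * of_real (inverse (real (Suc n)))) \<longlonglongrightarrow> parab x - \<i> * of_real 0"
    by (intro tendsto_intros LIMSEQ_inverse_real_of_nat)
  then have "(\<lambda>n. parab x - \<i> * of_real (inverse (real (Suc n)))) \<longlonglongrightarrow> parab x"
    by simp
  moreover have "parab x - \<i> * of_real (inverse (real (Suc n))) \<in> outside D" for n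
    by (intro below_parab_in_outside[OF D]) (auto simp: parab_def)
  ultimately have "parab x \<in> closure (outside D)"
    unfolding closure_sequential by (intro exI conjI allI)
  moreover have "parab x \<notin> interior (outside D)"
    using interior_subset x outside_no_overlap[of D] by blast
  ultimately show ?thesis
    by (simp add: frontier_def)
qed

section \<open>Noncrossing vertex orders (one-page book embeddings)\<close>

definition noncrossing :: "'a list \<Rightarrow> 'a set set \<Rightarrow> bool" where
  "noncrossing xs E \<longleftrightarrow> (\<forall>a b c d. {a, b} \<in> E \<longrightarrow> {c, d} \<in> E \<longrightarrow> \<not> subseq [a, c, b, d] xs)"

text \<open>Reads a subsequence off increasing positions, one entry at a time; with \<open>i\<close>
  just after the preceding position the result feeds the next application.\<close>

lemma subseq_nth_Cons:
  assumes "i \<le> j" "j < length xs" "subseq ys (drop (Suc j) xs)"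
  shows "subseq (xs ! j # ys) (drop i xs)"
proof -
  have "drop i xs = take (j - i) (drop i xs) @ xs ! j # drop (Suc j) xs"
    using assms(1,2) by (metis Cons_nth_drop_Suc append_take_drop_id drop_drop le_add_diff_inverse2)
  then show ?thesis
    using assms(3) by (metis subseq_Cons2 subseq_drop_many)
qed

text \<open>The vertex at position \<open>k\<close> is placed at \<open>parab k\<close> and edges
  become chords. Chords that do not interleave meet only in common ends, and the whole drawing lies
  on or above the parabola, so each vertex can be reached from below.\<close>

lemma outerplanar_noncrossing:
  assumes G: "simple_graph G" and xs: "distinct xs" "set xs = verts G" "noncrossing xs (edges G)"
  shows "outerplanar G"
proof -
  define pos where "pos = inv_into {..<length xs} ((!) xs)"
  have pos: "pos v < length xs" "xs ! pos v = v" if "v \<in> verts G" for v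
  proof -
    have "v \<in> set xs"
      using that xs(2) by simp
    then have "v \<in> (!) xs ` {..<length xs}"
      by (auto simp: in_set_conv_nth)
    then show "pos v < length xs" "xs ! pos v = v"
      using inv_into_into[of v "(!) xs" "{..<length xs}"] f_inv_into_f[of v "(!) xs" "{..<length xs}"]
      unfolding pos_def by auto
  qed
  have pos_inj: "pos v = pos w \<longleftrightarrow> v = w" if "v \<in> verts G" "w \<in> verts G" for v w
    using pos[OF that(1)] pos[OF that(2)] by metis
  have nc: "\<not> (pos a < pos c \<and> pos c < pos b \<and> pos b < pos d)"
    if "{a, b} \<in> edges G" "{c, d} \<in> edges G" for a b c d
  proof
    assume less: "pos a < pos c \<and> pos c < pos b \<and> pos b < pos d"
    have v: "a \<in> verts G" "b \<in> verts G" "c \<in> verts G" "d \<in> verts G"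
      using that G by (auto simp: simple_graph_def)
    have "subseq [xs ! pos a, xs ! pos c, xs ! pos b, xs ! pos d] (drop 0 xs)"
      using less pos(1)[OF v(4)] by (intro subseq_nth_Cons) auto
    then have "subseq [a, c, b, d] xs"
      using v pos(2) by simp
    then show False
      using xs(3) that unfolding noncrossing_def by blast
  qed
  have "\<exists>a b. e = {a, b} \<and> pos a < pos b" if e: "e \<in> edges G" for e
  proof -
    have e': "e \<subseteq> verts G" "card e = 2"
      using G e by (auto simp: simple_graph_def)
    then obtain a b where ab: "e = {a, b}" "a \<noteq> b"
      by (auto simp: card_2_iff)
    then have "pos a \<noteq> pos b"
      using e' pos_inj by auto
    then have "pos a < pos b \<or> pos b < pos a" by auto
    then show ?thesis using ab by (auto simp: insert_commute)
  qed
  then obtain A B where AB: "e = {A e, B e}" "pos (A e) < pos (B e)" if "e \<in> edges G" for e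
    by metis
  have AB_verts: "A e \<in> verts G" "B e \<in> verts G" if "e \<in> edges G" for e
    using AB(1)[OF that] G that unfolding simple_graph_def by blast+
  define p where "p v = parab (real (pos v))" for v
  define \<gamma> where "\<gamma> e = linepath (p (A e)) (p (B e))" for e
  have p_eq: "p v = p w \<longleftrightarrow> v = w" if "v \<in> verts G" "w \<in> verts G" for v w
    using pos_inj[OF that] by (simp add: p_def)
  have "plane_drawing G p \<gamma>"
    unfolding plane_drawing_def
  proof (intro conjI ballI impI)
    show "inj_on p (verts G)"
      using p_eq by (auto simp: inj_on_def)
    fix e assume e: "e \<in> edges G"
    show "arc (\<gamma> e)"
      using AB(2)[OF e] unfolding \<gamma>_def by (intro arc_linepath) (simp add: p_def)
    show "{pathstart (\<gamma> e), pathfinish (\<gamma> e)} = p ` e"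
      by (subst (3) AB(1)[OF e]) (simp add: \<gamma>_def)
  next
    fix e v assume e: "e \<in> edges G" and v: "v \<in> verts G" "p v \<in> path_image (\<gamma> e)"
    then have "real (pos v) = real (pos (A e)) \<or> real (pos v) = real (pos (B e))"
      by (intro parab_in_chord) (simp add: \<gamma>_def p_def)
    then have "v = A e \<or> v = B e"
      using pos_inj v AB_verts[OF e] by simp
    then show "v \<in> e"
      using AB(1)[OF e] by blast
  next
    fix e f assume e: "e \<in> edges G" and f: "f \<in> edges G" and "e \<noteq> f"
    then have ne: "(A e, B e) \<noteq> (A f, B f)"
      using AB(1) by (metis prod.inject)
    show "path_image (\<gamma> e) \<inter> path_image (\<gamma> f) \<subseteq> p ` (e \<inter> f)"
    proof
      fix z assume z: "z \<in> path_image (\<gamma> e) \<inter> path_image (\<gamma> f)"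
      have "{A e, B e} \<in> edges G" "{A f, B f} \<in> edges G"
        using AB(1) e f by auto
      then have "\<exists>w. z = parab w \<and> w \<in> {real (pos (A e)), real (pos (B e))} \<inter> {real (pos (A f)), real (pos (B f))}"
        using AB(2)[OF e] AB(2)[OF f] ne z nc pos_inj AB_verts e f
        by (intro chords_inter) (auto simp: \<gamma>_def p_def)
      then obtain r where r: "z = parab r" "r \<in> {real (pos (A e)), real (pos (B e))}"
        "r \<in> {real (pos (A f)), real (pos (B f))}"
        by blast
      obtain v where v: "v \<in> {A e, B e}" "r = real (pos v)"
        using r(2) by blast
      obtain w where w: "w \<in> {A f, B f}" "r = real (pos w)"
        using r(3) by blast
      have "v \<in> verts G" "w \<in> verts G" "pos v = pos w"
        using v w AB_verts[OF e] AB_verts[OF f] by auto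
      then have "v = w"
        using pos_inj by blast
      moreover have "z = p v"
        using r(1) v(2) by (simp add: p_def)
      ultimately show "z \<in> p ` (e \<inter> f)"
        using AB(1)[OF e] AB(1)[OF f] v(1) w(1) by blast
    qed
  qed
  moreover have "p ` verts G \<subseteq> frontier (outside (drawn_set G p \<gamma>))"
  proof
    fix z assume "z \<in> p ` verts G"
    then obtain v where v: "v \<in> verts G" "z = parab (real (pos v))"
      by (auto simp: p_def)
    have "(Re w)\<^sup>2 \<le> Im w" if "w \<in> drawn_set G p \<gamma>" for w
    proof -
      from that consider u where "w = parab u"
        | e where "w \<in> closed_segment (parab (real (pos (A e)))) (parab (real (pos (B e))))"
        by (auto simp: drawn_set_def \<gamma>_def p_def)
      then show ?thesis
        by cases (simp add: parab_def, rule chord_above)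
    qed
    moreover have "parab (real (pos v)) \<in> drawn_set G p \<gamma>"
      using v by (auto simp: drawn_set_def p_def)
    ultimately show "z \<in> frontier (outside (drawn_set G p \<gamma>))"
      unfolding v(2) by (rule parab_in_frontier_outside)
  qed
  ultimately show ?thesis
    unfolding outerplanar_def by blast
qed

section \<open>Gluing graphs along a new edge\<close>

definition glue :: "'a graph \<Rightarrow> 'a \<Rightarrow> 'a graph \<Rightarrow> 'a \<Rightarrow> 'a graph" where
  "glue G x H y = Graph (verts G \<union> verts H) (edges G \<union> edges H \<union> {{x, y}})"

text \<open>\<open>r\<close> is the first vertex of the order, so that the order can be inserted right after a vertex
  of another graph to which \<open>r\<close> gets joined. The vertices in \<open>B\<close> can take one more edge.\<close>

definition tame :: "'a graph \<Rightarrow> 'a \<Rightarrow> 'a set \<Rightarrow> bool" where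
  "tame G r B \<longleftrightarrow> simple_graph G \<and> B \<subseteq> verts G \<and>
     (\<forall>v\<in>verts G. degree G v + (if v \<in> B then 1 else 0) \<le> 3) \<and>
     (\<exists>xs. xs \<noteq> [] \<and> hd xs = r \<and> distinct xs \<and> set xs = verts G \<and> noncrossing xs (edges G))"

lemma simple_graph_finite_edges: "simple_graph G \<Longrightarrow> finite (edges G)"
  by (rule finite_subset[of _ "Pow (verts G)"]) (auto simp: simple_graph_def)

lemma subseq_set: "subseq xs ys \<Longrightarrow> set xs \<subseteq> set ys"
  by (rule subsetI) (erule list_emb_set, assumption, simp)

text \<open>By distinctness, the first entry \<open>c\<close> being in \<open>ws\<close> means that
  no entry comes from \<open>us\<close>, and the last entry \<open>d\<close> being there means that
  none comes from \<open>vs\<close>.\<close>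

lemma subseq_contiguous:
  assumes "subseq [c, b, d] (us @ ws @ vs)" "distinct (us @ ws @ vs)" "c \<in> set ws" "d \<in> set ws"
  shows "b \<in> set ws"
proof -
  obtain p q where pq: "[c, b, d] = p @ q" "subseq p us" "subseq q (ws @ vs)"
    using assms(1) by (rule subseq_appendE)
  have "c \<notin> set p"
    using subseq_set[OF pq(2)] assms(2,3) by auto
  then have "p = []"
    using pq(1) by (cases p) auto
  then have "subseq [c, b, d] (ws @ vs)"
    using pq by simp
  then obtain p q where pq: "[c, b, d] = p @ q" "subseq p ws" "subseq q vs"
    by (rule subseq_appendE)
  have "d \<notin> set q"
    using subseq_set[OF pq(3)] assms(2,4) by auto
  then have "q = []"
    using arg_cong[OF pq(1), of last] last_in_set[of q] by (cases "q = []") auto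
  then show ?thesis
    using pq(1) subseq_set[OF pq(2)] by auto
qed

lemma subseq_distinct: "subseq xs ys \<Longrightarrow> distinct ys \<Longrightarrow> distinct xs"
  by (auto simp: subseq_conv_nths)

lemma not_subseq_consecutive:
  assumes "distinct (us @ x # y # vs)" "{a, b} = {x, y}"
  shows "\<not> subseq [a, c, b] (us @ x # y # vs)"
proof
  assume s: "subseq [a, c, b] (us @ x # y # vs)"
  then have "c \<noteq> a" "c \<noteq> b"
    using subseq_distinct[OF s assms(1)] by auto
  moreover have "c \<in> set [x, y]"
    using s assms by (intro subseq_contiguous[of a c b us "[x, y]" vs]) auto
  ultimately show False
    using assms(2) by auto
qed

lemma subseq_restrict:
  assumes "subseq ws zs" "set ws \<subseteq> A"
  shows "subseq ws (filter (\<lambda>v. v \<in> A) zs)"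
  using subseq_filter[OF assms(1), of "\<lambda>v. v \<in> A"] assms(2) by (simp add: filter_id_conv subset_iff)

text \<open>The edge from \<open>x\<close> to \<open>y\<close> joins neighbours in the order and
  crosses nothing. Deleting one part gives back the order of the other, so two edges of the same
  part do not cross. An edge of \<open>F\<close> has both ends in the block \<open>y # ys\<close>,
  so an edge of \<open>E\<close> crossing it would have an end in that block.\<close>

lemma noncrossing_insert:
  assumes E: "noncrossing (us @ x # vs) E" "\<And>e. e \<in> E \<Longrightarrow> e \<subseteq> set (us @ x # vs)"
    and F: "noncrossing (y # ys) F" "\<And>e. e \<in> F \<Longrightarrow> e \<subseteq> set (y # ys)"
    and dist: "distinct (us @ x # y # ys @ vs)"
  shows "noncrossing (us @ x # y # ys @ vs) (E \<union> F \<union> {{x, y}})"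
  unfolding noncrossing_def
proof (intro allI impI notI)
  let ?zs = "us @ x # y # ys @ vs" and ?X = "set (us @ x # vs)" and ?Y = "set (y # ys)"
  fix a b c d
  assume ab: "{a, b} \<in> E \<union> F \<union> {{x, y}}" and cd: "{c, d} \<in> E \<union> F \<union> {{x, y}}"
    and s: "subseq [a, c, b, d] ?zs"
  have "subseq [a, c, b] [a, c, b, d]" "subseq [c, b, d] [a, c, b, d]"
    by auto
  then have acb: "subseq [a, c, b] ?zs" and cbd: "subseq [c, b, d] ?zs"
    using s by (blast intro: subseq_order.trans)+
  have "{a, b} \<noteq> {x, y}" "{c, d} \<noteq> {x, y}"
    using not_subseq_consecutive[OF dist] acb cbd by blast+
  then have ab: "{a, b} \<in> E \<or> {a, b} \<in> F" and cd: "{c, d} \<in> E \<or> {c, d} \<in> F"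
    using ab cd by auto
  have disj: "?X \<inter> ?Y = {}"
    using dist by auto
  have "filter (\<lambda>v. v \<in> ?X) us = us" "filter (\<lambda>v. v \<in> ?X) vs = vs" "filter (\<lambda>v. v \<in> ?X) ys = []"
    "y \<notin> ?X" "x \<in> ?X"
    using dist by (auto simp: filter_id_conv filter_empty_conv)
  then have fX: "filter (\<lambda>v. v \<in> ?X) ?zs = us @ x # vs"
    by (simp del: set_append set_simps)
  have "filter (\<lambda>v. v \<in> ?Y) us = []" "filter (\<lambda>v. v \<in> ?Y) vs = []" "filter (\<lambda>v. v \<in> ?Y) ys = ys"
    "x \<notin> ?Y" "y \<in> ?Y"
    using dist by (auto simp: filter_id_conv filter_empty_conv)
  then have fY: "filter (\<lambda>v. v \<in> ?Y) ?zs = y # ys"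
    by (simp del: set_append set_simps)
  show False
  proof (cases "{a, b} \<in> E"; cases "{c, d} \<in> E")
    assume *: "{a, b} \<in> E" "{c, d} \<in> E"
    then have "set [a, c, b, d] \<subseteq> ?X"
      using E(2)[OF *(1)] E(2)[OF *(2)] by auto
    from subseq_restrict[OF s this] show False
      using * E(1) unfolding fX noncrossing_def by blast
  next
    assume "{a, b} \<notin> E" "{c, d} \<notin> E"
    then have *: "{a, b} \<in> F" "{c, d} \<in> F"
      using ab cd by auto
    then have "set [a, c, b, d] \<subseteq> ?Y"
      using F(2)[OF *(1)] F(2)[OF *(2)] by auto
    from subseq_restrict[OF s this] show False
      using * F(1) unfolding fY noncrossing_def by blast
  next
    assume *: "{a, b} \<in> E" "{c, d} \<notin> E"
    then have "c \<in> ?Y" "d \<in> ?Y" "b \<in> ?X"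
      using cd E(2) F(2) by blast+
    moreover have "b \<in> ?Y"
      using cbd dist calculation by (intro subseq_contiguous[of c b d "us @ [x]" "y # ys" vs]) auto
    ultimately show False
      using disj by blast
  next
    assume *: "{a, b} \<notin> E" "{c, d} \<in> E"
    then have "a \<in> ?Y" "b \<in> ?Y" "c \<in> ?X"
      using ab E(2) F(2) by blast+
    moreover have "c \<in> ?Y"
      using acb dist calculation by (intro subseq_contiguous[of a c b "us @ [x]" "y # ys" vs]) auto
    ultimately show False
      using disj by blast
  qed
qed

text \<open>\<open>E\<close> is only required to be included in the union so that the lemma serves
  both sides of \<open>glue\<close>, with the graphs and the ends of the new edge exchanged.\<close>

lemma degree_glue:
  assumes G: "simple_graph G" "v \<in> verts G" and H: "\<And>e. e \<in> edges H \<Longrightarrow> v \<notin> e"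
    and E: "E \<subseteq> edges G \<union> edges H \<union> {{x, y}}" and y: "v \<noteq> y"
  shows "card {e \<in> E. v \<in> e} \<le> degree G v + (if v = x then 1 else 0)"
proof -
  have "{e \<in> E. v \<in> e} \<subseteq> {e \<in> edges G. v \<in> e} \<union> (if v = x then {{x, y}} else {})"
    using H E y by auto
  then have "card {e \<in> E. v \<in> e} \<le> card ({e \<in> edges G. v \<in> e} \<union> (if v = x then {{x, y}} else {}))"
    using simple_graph_finite_edges[OF G(1)] by (intro card_mono) auto
  also have "\<dots> \<le> card {e \<in> edges G. v \<in> e} + card (if v = x then {{x, y}} else {})"
    by (rule card_Un_le)
  finally show ?thesis
    by (simp add: degree_def split: if_splits)
qed

text \<open>The new edge uses up the spare degree of \<open>x\<close> and \<open>y\<close>, so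
  \<open>D\<close> omits both. The order of \<open>H\<close> starts with \<open>y\<close> and can go
  right after \<open>x\<close>, which leaves \<open>r\<close> in front.\<close>

lemma tame_glue:
  assumes G: "tame G r B" and H: "tame H y B'" and disj: "verts G \<inter> verts H = {}"
    and xy: "x \<in> B" "y \<in> B'" and D: "D \<subseteq> B - {x} \<union> (B' - {y})"
  shows "tame (glue G x H y) r D"
proof -
  have sG: "simple_graph G" and sH: "simple_graph H" and B: "B \<subseteq> verts G" and B': "B' \<subseteq> verts H"
    using G H by (auto simp: tame_def)
  have xy': "x \<in> verts G" "y \<in> verts H" "x \<noteq> y"
    using xy B B' disj by auto
  have subG: "e \<subseteq> verts G" if "e \<in> edges G" for e
    using sG that by (auto simp: simple_graph_def)
  have subH: "e \<subseteq> verts H" if "e \<in> edges H" for e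
    using sH that by (auto simp: simple_graph_def)
  have "simple_graph (glue G x H y)"
    using sG sH xy' by (auto simp: simple_graph_def glue_def)
  moreover have "D \<subseteq> verts (glue G x H y)"
    using D B B' by (auto simp: glue_def)
  moreover have "degree (glue G x H y) v + (if v \<in> D then 1 else 0) \<le> 3"
    if "v \<in> verts (glue G x H y)" for v
  proof -
    have dG: "degree G v + (if v \<in> B then 1 else 0) \<le> 3" if "v \<in> verts G"
      using G that by (simp add: tame_def)
    have dH: "degree H v + (if v \<in> B' then 1 else 0) \<le> 3" if "v \<in> verts H"
      using H that by (simp add: tame_def)
    have "v \<in> verts G \<union> verts H"
      using that by (simp add: glue_def)
    then consider "v \<in> verts G" "v \<notin> verts H" | "v \<in> verts H" "v \<notin> verts G"
      using disj by blast
    then show ?thesis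
    proof cases
      case 1
      then have "degree (glue G x H y) v \<le> degree G v + (if v = x then 1 else 0)"
        unfolding degree_def[of "glue G x H y"] using subH xy'
        by (intro degree_glue[OF sG, of v H _ x y]) (auto simp: glue_def)
      then show ?thesis
        using dG 1 D B' xy by (auto split: if_splits)
    next
      case 2
      then have "degree (glue G x H y) v \<le> degree H v + (if v = y then 1 else 0)"
        unfolding degree_def[of "glue G x H y"] using subG xy'
        by (intro degree_glue[OF sH, of v G _ y x]) (auto simp: glue_def)
      then show ?thesis
        using dH 2 D B xy by (auto split: if_splits)
    qed
  qed
  moreover have "\<exists>zs. zs \<noteq> [] \<and> hd zs = r \<and> distinct zs \<and> set zs = verts (glue G x H y) \<and>
      noncrossing zs (edges (glue G x H y))"
  proof -
    obtain xs where xs: "xs \<noteq> []" "hd xs = r" "distinct xs" "set xs = verts G" "noncrossing xs (edges G)"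
      using G by (auto simp: tame_def)
    obtain us vs where uv: "xs = us @ x # vs"
      using xs(4) xy'(1) by (metis split_list)
    obtain ys' where "ys' \<noteq> []" "hd ys' = y" "distinct ys'" "set ys' = verts H" "noncrossing ys' (edges H)"
      using H by (auto simp: tame_def)
    then obtain ys where ys: "distinct (y # ys)" "set (y # ys) = verts H" "noncrossing (y # ys) (edges H)"
      by (cases ys') auto
    have dist: "distinct (us @ x # y # ys @ vs)"
      using xs(3,4) ys(1,2) disj unfolding uv by auto
    moreover have "noncrossing (us @ x # y # ys @ vs) (edges (glue G x H y))"
      unfolding glue_def graph.sel using xs(4,5) ys(2,3) dist subG subH unfolding uv
      by (intro noncrossing_insert) auto
    moreover have "set (us @ x # y # ys @ vs) = verts (glue G x H y)"
      using xs(4) ys(2) unfolding uv by (auto simp: glue_def)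
    moreover have "hd (us @ x # y # ys @ vs) = r"
      using xs(2) unfolding uv by (cases us) auto
    ultimately show ?thesis by blast
  qed
  ultimately show ?thesis
    unfolding tame_def by blast
qed

definition map_graph :: "('a \<Rightarrow> 'b) \<Rightarrow> 'a graph \<Rightarrow> 'b graph" where
  "map_graph f G = Graph (f ` verts G) ((`) f ` edges G)"

lemma map_graph_sel [simp]:
  "verts (map_graph f G) = f ` verts G" "edges (map_graph f G) = (`) f ` edges G"
  by (simp_all add: map_graph_def)

lemma tame_map:
  assumes f: "inj f" and G: "tame G r B"
  shows "tame (map_graph f G) (f r) (f ` B)"
proof -
  have sG: "simple_graph G"
    using G by (auto simp: tame_def)
  have "simple_graph (map_graph f G)"
    using sG by (auto simp: simple_graph_def card_image[OF inj_on_subset[OF f subset_UNIV]])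
  moreover have "f ` B \<subseteq> verts (map_graph f G)"
    using G by (auto simp: tame_def)
  moreover have "degree (map_graph f G) w + (if w \<in> f ` B then 1 else 0) \<le> 3"
    if w: "w \<in> verts (map_graph f G)" for w
  proof -
    obtain v where v: "v \<in> verts G" "w = f v"
      using w by auto
    have "w \<in> f ` e \<longleftrightarrow> v \<in> e" for e
      using v(2) by (simp add: inj_image_mem_iff[OF f])
    then have "{e \<in> edges (map_graph f G). w \<in> e} = (`) f ` {e \<in> edges G. v \<in> e}"
      by auto
    then have "degree (map_graph f G) w \<le> degree G v"
      using simple_graph_finite_edges[OF sG] by (simp add: degree_def card_image_le)
    moreover have "w \<in> f ` B \<longleftrightarrow> v \<in> B"
      using v(2) by (simp add: inj_image_mem_iff[OF f])
    moreover have "degree G v + (if v \<in> B then 1 else 0) \<le> 3"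
      using G v(1) by (simp add: tame_def)
    ultimately show ?thesis by (simp split: if_splits)
  qed
  moreover have "\<exists>ys. ys \<noteq> [] \<and> hd ys = f r \<and> distinct ys \<and> set ys = verts (map_graph f G) \<and>
      noncrossing ys (edges (map_graph f G))"
  proof -
    obtain xs where xs: "xs \<noteq> []" "hd xs = r" "distinct xs" "set xs = verts G" "noncrossing xs (edges G)"
      using G by (auto simp: tame_def)
    have pre: "\<exists>a' b'. a = f a' \<and> b = f b' \<and> {a', b'} \<in> edges G"
      if ab: "{a, b} \<in> edges (map_graph f G)" for a b
    proof -
      obtain e where e: "e \<in> edges G" "{a, b} = f ` e"
        using ab by auto
      then obtain a' b' where "a = f a'" "b = f b'"
        by blast
      moreover from this e(2) have "e = {a', b'}"
        using inj_image_eq_iff[OF f, of e "{a', b'}"] by simp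
      ultimately show ?thesis
        using e(1) by blast
    qed
    have "\<not> subseq [a, c, b, d] (map f xs)"
      if ab: "{a, b} \<in> edges (map_graph f G)" and cd: "{c, d} \<in> edges (map_graph f G)" for a b c d
    proof
      assume s: "subseq [a, c, b, d] (map f xs)"
      obtain a' b' c' d' where *: "a = f a'" "b = f b'" "c = f c'" "d = f d'"
        "{a', b'} \<in> edges G" "{c', d'} \<in> edges G"
        using pre[OF ab] pre[OF cd] by blast
      \<comment> \<open>Injectivity lets the forbidden pattern be pulled back along
        \<open>inv f\<close>.\<close>
      have "subseq (map (inv f) [a, c, b, d]) (map (inv f) (map f xs))"
        using s by (rule subseq_map)
      then have "subseq [a', c', b', d'] xs"
        using f by (simp add: * comp_def)
      then show False
        using xs(5) * unfolding noncrossing_def by blast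
    qed
    then have "noncrossing (map f xs) (edges (map_graph f G))"
      unfolding noncrossing_def by blast
    moreover have "distinct (map f xs)" "hd (map f xs) = f r" "set (map f xs) = verts (map_graph f G)"
      using xs inj_on_subset[OF f subset_UNIV] by (auto simp: distinct_map hd_map)
    ultimately show ?thesis
      using xs(1) by (intro exI[of _ "map f xs"]) auto
  qed
  ultimately show ?thesis
    unfolding tame_def by blast
qed

section \<open>Tameness of the concrete graphs\<close>

definition graph_of :: "'a list \<Rightarrow> ('a \<times> 'a) list \<Rightarrow> 'a graph" where
  "graph_of xs L = Graph (set xs) ((\<lambda>(a, b). {a, b}) ` set L)"

text \<open>Reduces tameness to conditions on lists that can be evaluated, with \<open>xs\<close>
  itself as the order. The swapped pairs are added because \<open>noncrossing\<close> considers both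
  directions of an edge.\<close>

lemma tame_graph_of:
  assumes xs: "xs \<noteq> []" "distinct xs" and B: "set B \<subseteq> set xs"
    and L: "\<forall>(a, b)\<in>set L. a \<noteq> b \<and> a \<in> set xs \<and> b \<in> set xs"
    and deg: "\<forall>v\<in>set xs. length (filter (\<lambda>(a, b). v = a \<or> v = b) L) + (if v \<in> set B then 1 else 0) \<le> 3"
    and nc: "\<forall>(a, b)\<in>set (L @ map prod.swap L). \<forall>(c, d)\<in>set (L @ map prod.swap L). \<not> subseq [a, c, b, d] xs"
  shows "tame (graph_of xs L) (hd xs) (set B)"
proof -
  have d: "degree (graph_of xs L) v \<le> length (filter (\<lambda>(a, b). v = a \<or> v = b) L)" for v
  proof -
    have "{e \<in> edges (graph_of xs L). v \<in> e} =
        (\<lambda>(a, b). {a, b}) ` set (filter (\<lambda>(a, b). v = a \<or> v = b) L)"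
      by (auto simp: graph_of_def)
    also have "card \<dots> \<le> length (filter (\<lambda>(a, b). v = a \<or> v = b) L)"
      using card_length[of "map (\<lambda>(a, b). {a, b}) (filter (\<lambda>(a, b). v = a \<or> v = b) L)"] by simp
    finally show ?thesis
      by (simp add: degree_def)
  qed
  have "degree (graph_of xs L) v + (if v \<in> set B then 1 else 0) \<le> 3" if "v \<in> set xs" for v
    using d[of v] bspec[OF deg that] by linarith
  moreover have "noncrossing xs (edges (graph_of xs L))"
  proof -
    have "(a, b) \<in> set (L @ map prod.swap L)" if ab: "{a, b} \<in> edges (graph_of xs L)" for a b
    proof -
      obtain c d where "(c, d) \<in> set L" "{a, b} = {c, d}"
        using ab by (auto simp: graph_of_def)
      then have "(a, b) \<in> set L \<or> (b, a) \<in> set L"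
        by (auto simp: doubleton_eq_iff)
      then show ?thesis
        using image_eqI[of "(a, b)" prod.swap "(b, a)" "set L"] by auto
    qed
    then show ?thesis
      using nc unfolding noncrossing_def by blast
  qed
  moreover have "simple_graph (graph_of xs L)"
    using L by (auto simp: simple_graph_def graph_of_def)
  ultimately show ?thesis
    unfolding tame_def using xs B by (intro conjI exI[of _ xs]) (simp_all add: graph_of_def)
qed

text \<open>The order follows the Hamiltonian cycle of \<open>G1\<close>; the other edges,
  \<open>{2, 3}\<close>, \<open>{6, 7}\<close>, \<open>{4, 5}\<close> and \<open>{9, 10}\<close>,
  are noncrossing chords of it.\<close>

lemma graph_of_G1: "graph_of [1, 2, 6, 8, 7, 3, 4, 10, 11, 9, 5] G1_edges = G1"
proof -
  have "{1..11} = set [1, 2, 6, 8, 7, 3, 4, 10, 11, 9, 5 :: nat]"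
    by code_simp
  moreover have "(\<lambda>(a, b). {a, b}) ` set G1_edges = edges G1"
    unfolding G1_edges_def G1_def by (intro equalityI; simp)
  ultimately show ?thesis
    by (simp add: graph_of_def G1_def)
qed

lemma tame_G1: "tame G1 1 {1, 8, 11}"
proof -
  have "tame (graph_of [1, 2, 6, 8, 7, 3, 4, 10, 11, 9, 5] G1_edges)
      (hd [1, 2, 6, 8, 7, 3, 4, 10, 11, 9, 5]) (set [1, 8, 11])"
    unfolding G1_edges_def by (intro tame_graph_of; code_simp)
  then show ?thesis
    unfolding graph_of_G1 by simp
qed

text \<open>The graph on the vertices \<open>V i\<close> alone. After 1, 2, 3 the order runs around
  the 5-cycle through 4 and then around the one through 5.\<close>

definition head :: "nat graph" where
  "head = graph_of [1, 2, 3, 4, 6, 8, 9, 7, 5, 10, 12, 13, 11]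
     [(1, 2), (1, 4), (1, 5), (2, 3), (4, 6), (4, 7), (6, 7), (6, 8), (7, 9), (8, 9),
      (5, 10), (5, 11), (10, 11), (10, 12), (11, 13), (12, 13)]"

lemma tame_head: "tame head 1 {2, 8, 9, 12, 13}"
proof -
  have "tame head (hd [1, 2, 3, 4, 6, 8, 9, 7, 5, 10, 12, 13, 11]) (set [2, 8, 9, 12, 13])"
    unfolding head_def by (intro tame_graph_of; code_simp)
  then show ?thesis
    by simp
qed

abbreviation G1_copy :: "nat \<Rightarrow> (nat \<times> nat) graph" where
  "G1_copy c \<equiv> map_graph (Pair c) G1"

lemma tame_G1_copy: "tame (G1_copy c) (c, 1) {(c, 1), (c, 8), (c, 11)}"
  using tame_map[OF _ tame_G1, of "Pair c"] by (simp add: inj_on_def)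

text \<open>Splits edge sets into unions of singletons, to be compared by the laws of union. A lone
  singleton does not match, which avoids looping, and the type of \<open>a\<close> keeps the edges
  themselves from being split.\<close>

lemma insert_insert_Un:
  fixes a :: "'a set"
  shows "insert a (insert b A) = {a} \<union> insert b A" "insert a (A \<union> B) = {a} \<union> (A \<union> B)"
  by auto

lemma Times_UN: "A \<times> B = (\<Union>a\<in>A. Pair a ` B)"
  by auto

lemma tame_G2: "tame G2 (1, 1) {(1, 1)}"
proof -
  define H2 where "H2 = glue (G1_copy 1) (1, 8) (G1_copy 2) (2, 1)"
  define H3 where "H3 = glue H2 (1, 11) (G1_copy 3) (3, 1)"
  define H4 where "H4 = glue H3 (2, 8) (G1_copy 4) (4, 1)"
  define H5 where "H5 = glue H4 (2, 11) (G1_copy 5) (5, 1)"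
  define H6 where "H6 = glue H5 (3, 8) (G1_copy 6) (6, 1)"
  define H7 where "H7 = glue H6 (3, 11) (G1_copy 7) (7, 1)"
  note H = H7_def H6_def H5_def H4_def H3_def H2_def
  note sel = glue_def graph.sel map_graph_sel
  \<comment> \<open>The sets list the vertices still awaiting a link, together with
    \<open>(1, 1)\<close>, which is kept for the edge to the rest of \<open>G3\<close>.\<close>
  have 2: "tame H2 (1, 1) {(1, 1), (1, 11), (2, 8), (2, 11)}"
    unfolding H2_def by (rule tame_glue[OF tame_G1_copy tame_G1_copy]) auto
  have 3: "tame H3 (1, 1) {(1, 1), (2, 8), (2, 11), (3, 8), (3, 11)}"
    unfolding H3_def by (rule tame_glue[OF 2 tame_G1_copy]) (auto simp: H2_def sel)
  have 4: "tame H4 (1, 1) {(1, 1), (2, 11), (3, 8), (3, 11)}"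
    unfolding H4_def by (rule tame_glue[OF 3 tame_G1_copy]) (auto simp: H3_def H2_def sel)
  have 5: "tame H5 (1, 1) {(1, 1), (3, 8), (3, 11)}"
    unfolding H5_def by (rule tame_glue[OF 4 tame_G1_copy]) (auto simp: H4_def H3_def H2_def sel)
  have 6: "tame H6 (1, 1) {(1, 1), (3, 11)}"
    unfolding H6_def by (rule tame_glue[OF 5 tame_G1_copy]) (auto simp: H5_def H4_def H3_def H2_def sel)
  have 7: "tame H7 (1, 1) {(1, 1)}"
    unfolding H7_def by (rule tame_glue[OF 6 tame_G1_copy]) (auto simp: H6_def H5_def H4_def H3_def H2_def sel)
  have seven: "{1..7} = {1, 2, 3, 4, 5, 6, 7 :: nat}"
    by auto
  have "verts H7 = verts G2"
    unfolding G2_def H sel seven Times_UN UN_insert UN_empty by (simp only: Un_ac Un_empty_left Un_empty_right)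
  moreover have "edges H7 = edges G2"
    unfolding G2_def H sel seven UN_insert UN_empty
    by (simp only: insert_insert_Un Un_ac Un_empty_left Un_empty_right)
  ultimately have "H7 = G2"
    by (simp add: graph.expand)
  with 7 show ?thesis by simp
qed

abbreviation G2_copy :: "label \<Rightarrow> vertex graph" where
  "G2_copy l \<equiv> map_graph (U l) G2"

lemma tame_G2_copy: "tame (G2_copy l) (u1 l) {u1 l}"
  using tame_map[OF _ tame_G2, of "U l"] by (simp add: inj_on_def)

lemma UNIV_label: "UNIV = {La, Lb, Lc, Ld, Le}"
  by (auto intro: label.exhaust)

lemma tame_G3: "tame G3 (V 1) {}"
proof -
  define Ha where "Ha = glue (map_graph V head) (V 2) (G2_copy La) (u1 La)"
  define Hb where "Hb = glue Ha (V 8) (G2_copy Lb) (u1 Lb)"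
  define Hc where "Hc = glue Hb (V 9) (G2_copy Lc) (u1 Lc)"
  define Hd where "Hd = glue Hc (V 12) (G2_copy Ld) (u1 Ld)"
  define He where "He = glue Hd (V 13) (G2_copy Le) (u1 Le)"
  note H = He_def Hd_def Hc_def Hb_def Ha_def
  note sel = glue_def graph.sel map_graph_sel
  have 0: "tame (map_graph V head) (V 1) {V 2, V 8, V 9, V 12, V 13}"
    using tame_map[OF _ tame_head, of V] by (simp add: inj_on_def)
  have a: "tame Ha (V 1) {V 8, V 9, V 12, V 13}"
    unfolding Ha_def by (rule tame_glue[OF 0 tame_G2_copy]) auto
  have b: "tame Hb (V 1) {V 9, V 12, V 13}"
    unfolding Hb_def by (rule tame_glue[OF a tame_G2_copy]) (auto simp: Ha_def sel)
  have c: "tame Hc (V 1) {V 12, V 13}"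
    unfolding Hc_def by (rule tame_glue[OF b tame_G2_copy]) (auto simp: Hb_def Ha_def sel)
  have d: "tame Hd (V 1) {V 13}"
    unfolding Hd_def by (rule tame_glue[OF c tame_G2_copy]) (auto simp: Hc_def Hb_def Ha_def sel)
  have e: "tame He (V 1) {}"
    unfolding He_def by (rule tame_glue[OF d tame_G2_copy]) (auto simp: Hd_def Hc_def Hb_def Ha_def sel)
  have "{1..13} = set [1, 2, 3, 4, 6, 8, 9, 7, 5, 10, 12, 13, 11 :: nat]"
    by code_simp
  then have "verts (map_graph V head) = V ` {1..13}"
    by (simp only: head_def graph_of_def sel)
  then have "verts He = verts G3"
    unfolding G3_def H glue_def graph.sel UNIV_label UN_insert UN_empty
    by (simp only: map_graph_sel(1)[of "U _"] Un_ac Un_empty_left Un_empty_right)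
  moreover have "edges (map_graph V head) =
      {{V 1, V 2}, {V 1, V 4}, {V 1, V 5}, {V 2, V 3}, {V 4, V 6}, {V 4, V 7}, {V 6, V 7},
       {V 6, V 8}, {V 7, V 9}, {V 8, V 9}, {V 5, V 10}, {V 5, V 11}, {V 10, V 11}, {V 10, V 12},
       {V 11, V 13}, {V 12, V 13}}"
    by (simp add: head_def graph_of_def)
  then have "edges He = edges G3"
    unfolding G3_def H glue_def graph.sel UNIV_label UN_insert UN_empty
    by (simp only: map_graph_sel(2)[of "U _"] insert_insert_Un Un_ac Un_empty_left Un_empty_right)
  ultimately have "He = G3"
    by (simp add: graph.expand)
  with e show ?thesis by simp
qed

lemma tame_outerplanar:
  assumes "tame G r B"
  shows "simple_graph G" "subcubic G" "outerplanar G"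
proof -
  show "simple_graph G" "subcubic G"
    using assms by (auto simp: tame_def subcubic_def intro: add_leD1)
  show "outerplanar G"
    using assms outerplanar_noncrossing by (auto simp: tame_def)
qed

theorem mainTheorem10:
  "simple_graph G3 \<and> subcubic G3 \<and> outerplanar G3 \<and>
   \<not> (\<exists>C. packing_edge_coloring [1, 1, 2, 2, 5] G3 C)"
  using tame_outerplanar[OF tame_G3] no_packing_G3 by blast

end
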